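(* Consider a system with phase space $\Omega$ and Lebesgue measure $\mu_{\rm L}$, driven from time $0$ to $\tau$, in contact with a heat bath of inverse temperature $\beta=1/(k_{\rm B}T)>0$, with time reversal as the reference dynamics, satisfying the detailed fluctuation relation stated in the context. Suppose the initial distribution of the original process is absolutely continuous, $\mu_0(d\Gamma_0)=p_0(\Gamma_0)\mu_{\rm L}(d\Gamma_0)$, and that the initial distribution of the time-reversed process is the final distribution of the original process, $\mu_0^\dagger=\mu_\tau$. Let $p_\tau=d\mu_{\tau,\rm AC}/d\mu_{\rm L}$ be the density of the absolutely continuous part of $\mu_\tau$ with respect to $\mu_{\rm L}$, and let the total entropy production be $$\Delta s_{\rm tot}=\Delta s_{\rm bath}+\Delta s,\qquad \Delta s_{\rm bath}=\frac{Q}{T},\qquad \Delta s=-k_{\rm B}\ln p_\tau(\Gamma_\tau)+k_{\rm B}\ln p_0(\Gamma_0).$$ Then $$\langle e^{-\Delta s_{\rm tot}/k_{\rm B}}\rangle=1-\lambda_{\rm S}.$$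
   Context: Paths $\Gamma=(\Gamma_t)_{0\le t\le\tau}$ take values in $\Omega$. $\mathcal{M}$ is the probability measure on paths of the original process (initial law $\mu_0$, law of $\Gamma_\tau$ denoted $\mu_\tau$), and $\mathcal{M}^{\rm r}$ is the probability measure of the time-reversed process started from $\mu_0^\dagger$ (expressed as a distribution of the end point $\Gamma_\tau$ of the forward path) under the time-reversed protocol, transported to forward paths by time reversal. $\mathcal{M}^{\rm r}=\mathcal{M}^{\rm r}_{\rm AC}+\mathcal{M}^{\rm r}_{\rm S}$ is the Lebesgue decomposition with respect to $\mathcal{M}$, and $\lambda_{\rm S}$ is the total mass of $\mathcal{M}^{\rm r}_{\rm S}$. $\langle\cdot\rangle$ is the average over $\mathcal{M}$; $Q[\Gamma]$ is the heat dissipated to the bath along $\Gamma$. Conventions: $-\ln 0=+\infty$ and $e^{-\infty}=0$. Detailed fluctuation relation (the property of the Langevin or Hamiltonian dynamics that is used): for $\mathcal{M}$-almost every $\Gamma$, $$\frac{d\mathcal{M}^{\rm r}_{\rm AC}}{d\mathcal{M}}(\Gamma)=e^{-\beta Q[\Gamma]}\;\frac{d\mu_{\rm L,AC}}{d\mu_0}(\Gamma_0)\;\frac{d\mu^\dagger_{0,\rm AC}}{d\mu_{\rm L}}(\Gamma_\tau),$$ where $\mu_{\rm L,AC}$ is the absolutely continuous part of $\mu_{\rm L}$ with respect to $\mu_0$, and $\mu^\dagger_{0,\rm AC}$ is the absolutely continuous part of $\mu_0^\dagger$ with respect to $\mu_{\rm L}$. *)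

theory Defs
  imports "HOL-Probability.Probability"
begin

section \<open>Lebesgue decomposition\<close>

definition mutually_singular :: "'a measure \<Rightarrow> 'a measure \<Rightarrow> bool" where
  "mutually_singular M N \<longleftrightarrow>
     (\<exists>A\<in>sets M. emeasure M A = 0 \<and> emeasure N (space M - A) = 0)"

definition lebesgue_decomposition ::
  "'a measure \<Rightarrow> 'a measure \<Rightarrow> 'a measure \<Rightarrow> 'a measure \<Rightarrow> bool" where
  "lebesgue_decomposition M N Nac Ns \<longleftrightarrow>
     sets Nac = sets M \<and> sets Ns = sets M \<and>
     absolutely_continuous M Nac \<and> mutually_singular M Ns \<and>
     (\<forall>A\<in>sets M. emeasure N A = emeasure Nac A + emeasure Ns A)"

text \<open>In both operators the first argument is the reference measure, as for
  \<^const>\<open>absolutely_continuous\<close> and \<^const>\<open>RN_deriv\<close>. The lemma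
  \<open>lebesgue_decomposition_parts\<close> below shows that they are well defined.\<close>

definition ac_part :: "'a measure \<Rightarrow> 'a measure \<Rightarrow> 'a measure" where
  "ac_part M N = (THE Nac. \<exists>Ns. lebesgue_decomposition M N Nac Ns)"

definition sing_part :: "'a measure \<Rightarrow> 'a measure \<Rightarrow> 'a measure" where
  "sing_part M N = (THE Ns. \<exists>Nac. lebesgue_decomposition M N Nac Ns)"

lemma lebesgue_decomposition_exists:
  assumes "sigma_finite_measure N" and sets_eq: "sets N = sets M"
  shows "\<exists>Nac Ns. lebesgue_decomposition M N Nac Ns"
proof -
  interpret N: sigma_finite_measure N by fact
  obtain f :: "'a \<Rightarrow> real" where f[measurable]: "f \<in> borel_measurable N"
    and fpos: "\<And>x. f x > 0" and fint: "integrable N f"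
    using N.obtain_positive_integrable_function by metis
  define N' where "N' = density N (\<lambda>x. ennreal (f x))"
  have sp: "space N = space M" using sets_eq by (rule sets_eq_imp_space_eq)
  have sets': "sets N' = sets M" unfolding N'_def using sets_eq by simp
  have "emeasure N' (space N') = (\<integral>\<^sup>+x. ennreal (f x) \<partial>N)"
    unfolding N'_def by (simp add: emeasure_density cong: nn_integral_cong)
  also have "\<dots> < \<infinity>"
    using fint fpos by (simp add: nn_integral_eq_integral less_imp_le)
  finally interpret N': finite_measure N'
    by (intro finite_measureI) simp
  have "(null_sets M) \<noteq> {}" by auto
  then obtain A where A: "range A \<subseteq> emeasure N' ` null_sets M"
    and sup: "(SUP X\<in>null_sets M. emeasure N' X) = (SUP i::nat. A i)"
    using ennreal_SUP_countable_SUP[of "null_sets M" "emeasure N'"] by auto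
  from A have "\<forall>i. \<exists>X. X \<in> null_sets M \<and> A i = emeasure N' X" by blast
  then obtain X where X: "\<And>i. X i \<in> null_sets M" "\<And>i. A i = emeasure N' (X i)"
    by metis
  define B where "B = (\<Union>i. X i)"
  have B: "B \<in> null_sets M" unfolding B_def using X by auto
  then have BM: "B \<in> sets M" by auto
  have Bmax: "emeasure N' Y \<le> emeasure N' B" if "Y \<in> null_sets M" for Y
  proof -
    have "emeasure N' Y \<le> (SUP X\<in>null_sets M. emeasure N' X)"
      using that by (rule SUP_upper)
    also have "\<dots> \<le> emeasure N' B"
      unfolding sup by (rule SUP_least) (use X BM sets' in \<open>auto simp: B_def intro!: emeasure_mono\<close>)
    finally show ?thesis .
  qed
  define Nac where "Nac = density N (indicator (space M - B))"
  define Ns where "Ns = density N (indicator B)"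
  have BN[measurable]: "B \<in> sets N" "space M - B \<in> sets N"
    using BM sets_eq by auto
  have eNac: "emeasure Nac Y = emeasure N (Y - B)" if "Y \<in> sets M" for Y
  proof -
    have "(space M - B) \<inter> Y = Y - B" using sets.sets_into_space[OF that] by auto
    then show ?thesis using that sets_eq BN
      by (simp add: Nac_def emeasure_density nn_integral_indicator
          flip: indicator_inter_arith)
  qed
  have eNs: "emeasure Ns Y = emeasure N (Y \<inter> B)" if "Y \<in> sets M" for Y
    using that sets_eq BN
    by (simp add: Ns_def emeasure_density nn_integral_indicator Int_commute
          flip: indicator_inter_arith)
  have "absolutely_continuous M Nac"
    unfolding absolutely_continuous_def
  proof
    fix C assume C: "C \<in> null_sets M"
    then have CM: "C \<in> sets M" by auto
    have "emeasure N' B + emeasure N' (C - B) = emeasure N' (B \<union> C)"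
      using BM CM sets' by (subst plus_emeasure) auto
    also have "\<dots> \<le> emeasure N' B" using B C by (intro Bmax) auto
    finally have "emeasure N' (C - B) = 0"
      using N'.emeasure_finite[of B] ennreal_add_left_cancel_le[of "emeasure N' B" _ 0]
      by simp
    then have "C - B \<in> null_sets N'" using CM BM sets' by auto
    then have "AE x in N. x \<in> C - B \<longrightarrow> ennreal (f x) \<le> 0"
      unfolding N'_def by (subst (asm) null_sets_density_iff) auto
    then have "AE x in N. x \<notin> C - B"
      by eventually_elim (use fpos in \<open>auto simp: ennreal_eq_0_iff not_le[symmetric]\<close>)
    then have "C - B \<in> null_sets N"
      using CM BM sets_eq by (subst AE_iff_null_sets) auto
    then show "C \<in> null_sets Nac"
      using eNac[OF CM] CM sets_eq by (auto simp: null_sets_def Nac_def)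
  qed
  moreover have "mutually_singular M Ns"
    unfolding mutually_singular_def
    by (rule bexI[of _ B]) (use B BM in \<open>auto simp: eNs Int_commute[of "space M - B"]\<close>)
  moreover have "emeasure N Y = emeasure Nac Y + emeasure Ns Y" if "Y \<in> sets M" for Y
  proof -
    have "Y = (Y - B) \<union> (Y \<inter> B)" by auto
    then have "emeasure N Y = emeasure N ((Y - B) \<union> (Y \<inter> B))" by simp
    also have "\<dots> = emeasure N (Y - B) + emeasure N (Y \<inter> B)"
      using that BM sets_eq by (subst plus_emeasure[symmetric]) auto
    finally show ?thesis using that by (simp add: eNac eNs)
  qed
  ultimately have "lebesgue_decomposition M N Nac Ns"
    unfolding lebesgue_decomposition_def using sets_eq by (simp add: Nac_def Ns_def)
  then show ?thesis by blast
qed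

lemma lebesgue_decomposition_unique:
  assumes D: "lebesgue_decomposition M N Nac Ns" and E: "lebesgue_decomposition M N Nac' Ns'"
  shows "Nac = Nac'" and "Ns = Ns'"
proof -
  obtain A where A: "A \<in> null_sets M" "emeasure Ns (space M - A) = 0"
    using D by (auto simp: lebesgue_decomposition_def mutually_singular_def)
  obtain A' where A': "A' \<in> null_sets M" "emeasure Ns' (space M - A') = 0"
    using E by (auto simp: lebesgue_decomposition_def mutually_singular_def)
  define B where "B = A \<union> A'"
  have B: "B \<in> null_sets M" using A A' by (auto simp: B_def)
  have *: "emeasure Kac Y = emeasure N (Y - B) \<and> emeasure Ks Y = emeasure N (Y \<inter> B)"
    if K: "lebesgue_decomposition M N Kac Ks" and Z: "Z \<in> null_sets M" "Z \<subseteq> B"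
      "emeasure Ks (space M - Z) = 0" and Y: "Y \<in> sets M" for Kac Ks Z Y
  proof -
    note sets = K[unfolded lebesgue_decomposition_def, THEN conjunct1]
      K[unfolded lebesgue_decomposition_def, THEN conjunct2, THEN conjunct1]
    have add: "emeasure N V = emeasure Kac V + emeasure Ks V" if "V \<in> sets M" for V
      using K that by (auto simp: lebesgue_decomposition_def)
    have Bac: "B \<in> null_sets Kac"
      using K B by (auto simp: lebesgue_decomposition_def absolutely_continuous_def)
    have BM: "B \<in> sets M" using B by auto
    have ZM: "space M - Z \<in> null_sets Ks" using Z sets by (auto simp: null_sets_def)
    have "Y - B \<in> null_sets Ks"
      by (rule null_sets_subset[OF ZM]) (use Y BM sets Z sets.sets_into_space[OF Y] in auto)
    then have s0: "emeasure Ks (Y - B) = 0" by auto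
    have "Y \<inter> B \<in> null_sets Kac"
      by (rule null_sets_subset[OF Bac]) (use Y BM sets in auto)
    then have a0: "emeasure Kac (Y \<inter> B) = 0" by auto
    have split: "emeasure L Y = emeasure L (Y - B) + emeasure L (Y \<inter> B)"
      if "sets L = sets M" for L
    proof -
      have "Y = (Y - B) \<union> (Y \<inter> B)" by auto
      then have "emeasure L Y = emeasure L ((Y - B) \<union> (Y \<inter> B))" by simp
      also have "\<dots> = emeasure L (Y - B) + emeasure L (Y \<inter> B)"
        using that Y BM by (subst plus_emeasure[symmetric]) auto
      finally show ?thesis .
    qed
    show ?thesis
      using split[of Kac] split[of Ks] sets s0 a0 add[of "Y - B"] add[of "Y \<inter> B"] Y BM
      by auto
  qed
  have 1: "A \<subseteq> B" "A' \<subseteq> B" by (auto simp: B_def)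
  have s: "sets Nac = sets M" "sets Nac' = sets M" "sets Ns = sets M" "sets Ns' = sets M"
    using D E by (auto simp: lebesgue_decomposition_def)
  show "Nac = Nac'"
    by (rule measure_eqI) (use s *[OF D A(1) 1(1) A(2)] *[OF E A'(1) 1(2) A'(2)] in auto)
  show "Ns = Ns'"
    by (rule measure_eqI) (use s *[OF D A(1) 1(1) A(2)] *[OF E A'(1) 1(2) A'(2)] in auto)
qed

lemma lebesgue_decomposition_parts:
  assumes "sigma_finite_measure N" and "sets N = sets M"
  shows "lebesgue_decomposition M N (ac_part M N) (sing_part M N)"
proof -
  obtain Nac Ns where D: "lebesgue_decomposition M N Nac Ns"
    using lebesgue_decomposition_exists[OF assms] by blast
  have "ac_part M N = Nac" unfolding ac_part_def
    by (rule the_equality) (use D lebesgue_decomposition_unique in blast)+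
  moreover have "sing_part M N = Ns" unfolding sing_part_def
    by (rule the_equality) (use D lebesgue_decomposition_unique in blast)+
  ultimately show ?thesis using D by simp
qed


section \<open>Logarithm and exponential with extended values\<close>

definition ennreal_ln :: "ennreal \<Rightarrow> ereal" where
  "ennreal_ln x = (if x = 0 then -\<infinity> else if x = \<infinity> then \<infinity> else ereal (ln (enn2real x)))"

definition ereal_exp :: "ereal \<Rightarrow> ennreal" where
  "ereal_exp x = (if x = -\<infinity> then 0 else if x = \<infinity> then \<infinity> else ennreal (exp (real_of_ereal x)))"


section \<open>Paths and time reversal\<close>

definition phase_measure :: "'a::euclidean_space set \<Rightarrow> 'a measure" where
  "phase_measure \<Omega> = restrict_space lborel \<Omega>"

text \<open>\<open>P\<close> serves only as a measurable space of paths; neither the regularity of the paths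
  nor the particular sigma-algebra is fixed.\<close>

definition path_space :: "'a::euclidean_space set \<Rightarrow> real \<Rightarrow> (real \<Rightarrow> 'a) measure \<Rightarrow> bool" where
  "path_space \<Omega> \<tau> P \<longleftrightarrow>
     space P \<subseteq> {0..\<tau>} \<rightarrow>\<^sub>E \<Omega> \<and>
     (\<forall>t\<in>{0..\<tau>}. (\<lambda>\<Gamma>. \<Gamma> t) \<in> P \<rightarrow>\<^sub>M phase_measure \<Omega>)"

text \<open>\<open>\<theta>\<close> is the conjugation of a phase-space point under time reversal: it flips
  the momenta, and is the identity for overdamped dynamics.\<close>

definition time_reversal :: "real \<Rightarrow> ('a \<Rightarrow> 'a) \<Rightarrow> (real \<Rightarrow> 'a) \<Rightarrow> (real \<Rightarrow> 'a)" where
  "time_reversal \<tau> \<theta> \<Gamma> = (\<lambda>t\<in>{0..\<tau>}. \<theta> (\<Gamma> (\<tau> - t)))"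


section \<open>Detailed fluctuation relation and entropy production\<close>

text \<open>Where \<open>\<mu>0dag\<close> has a singular part, the value of the last factor at \<open>\<Gamma> \<tau>\<close> may
  depend on the version of the derivative. \<^const>\<open>RN_deriv\<close> denotes one fixed version, used both
  here and for the final density in the entropy production.\<close>

definition detailed_fluctuation_relation ::
  "real \<Rightarrow> ((real \<Rightarrow> 'a) \<Rightarrow> real) \<Rightarrow> 'a measure \<Rightarrow> real \<Rightarrow> 'a measure \<Rightarrow> 'a measure \<Rightarrow>
   (real \<Rightarrow> 'a) measure \<Rightarrow> (real \<Rightarrow> 'a) measure \<Rightarrow> bool" where
  "detailed_fluctuation_relation \<beta> Q \<mu>L \<tau> \<mu>0 \<mu>0dag M Mr \<longleftrightarrow>
     (AE \<Gamma> in M. RN_deriv M (ac_part M Mr) \<Gamma> =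
        ennreal (exp (- \<beta> * Q \<Gamma>)) *
        RN_deriv \<mu>0 (ac_part \<mu>0 \<mu>L) (\<Gamma> 0) *
        RN_deriv \<mu>L (ac_part \<mu>L \<mu>0dag) (\<Gamma> \<tau>))"

definition bath_entropy :: "real \<Rightarrow> ((real \<Rightarrow> 'a) \<Rightarrow> real) \<Rightarrow> (real \<Rightarrow> 'a) \<Rightarrow> real" where
  "bath_entropy T Q \<Gamma> = Q \<Gamma> / T"

definition system_entropy ::
  "real \<Rightarrow> real \<Rightarrow> ('a \<Rightarrow> real) \<Rightarrow> ('a \<Rightarrow> ennreal) \<Rightarrow> (real \<Rightarrow> 'a) \<Rightarrow> ereal" where
  "system_entropy k \<tau> p0 p\<tau> \<Gamma> =
     - ereal k * ennreal_ln (p\<tau> (\<Gamma> \<tau>)) + ereal k * ennreal_ln (ennreal (p0 (\<Gamma> 0)))"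

definition total_entropy ::
  "real \<Rightarrow> real \<Rightarrow> ((real \<Rightarrow> 'a) \<Rightarrow> real) \<Rightarrow> real \<Rightarrow> ('a \<Rightarrow> real) \<Rightarrow> ('a \<Rightarrow> ennreal) \<Rightarrow>
   (real \<Rightarrow> 'a) \<Rightarrow> ereal" where
  "total_entropy k T Q \<tau> p0 p\<tau> \<Gamma> =
     ereal (bath_entropy T Q \<Gamma>) + system_entropy k \<tau> p0 p\<tau> \<Gamma>"

end

theory Submission
  imports Defs
begin

text \<open>Since \<open>\<mu>0 = p0 \<mu>L\<close>, the absolutely continuous part of \<open>\<mu>L\<close> with respect to \<open>\<mu>0\<close> has density
  \<open>1 / p0\<close>, so the detailed fluctuation relation identifies \<open>exp (- \<Delta>s_tot / kB)\<close> with the density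
  of the absolutely continuous part of \<open>Mr\<close>, almost surely under \<open>M\<close>. Its integral is the total
  mass of \<open>Mr\<close> minus that of the singular part.\<close>

lemma ac_part_eqI:
  assumes "lebesgue_decomposition M N Nac Ns"
  shows "ac_part M N = Nac"
  unfolding ac_part_def
  by (rule the_equality) (use assms lebesgue_decomposition_unique in blast)+

text \<open>The zero set of \<open>f\<close> is null for \<open>density N f\<close>, so the
  restriction of \<open>N\<close> to it is singular; on the complement, multiplying by
  \<open>f\<close> and then by \<open>1 / f\<close> restores \<open>N\<close>.\<close>

lemma lebesgue_decomposition_density:
  fixes f :: "'a \<Rightarrow> real"
  assumes f[measurable]: "f \<in> borel_measurable N" and nonneg: "\<And>x. x \<in> space N \<Longrightarrow> 0 \<le> f x"
  shows "lebesgue_decomposition (density N f) N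
    (density (density N f) (\<lambda>x. ennreal (1 / f x)))
    (density N (indicator {x\<in>space N. f x = 0}))"
proof -
  define Z where "Z = {x\<in>space N. f x = 0}"
  have Z[measurable]: "Z \<in> sets N" unfolding Z_def by measurable
  have "emeasure (density N f) Z = (\<integral>\<^sup>+x. 0 \<partial>N)"
    by (subst emeasure_density, simp, simp, rule nn_integral_cong) (auto simp: Z_def indicator_def)
  moreover have "emeasure (density N (indicator Z)) (space N - Z) = (\<integral>\<^sup>+x. 0 \<partial>N)"
    by (subst emeasure_density, simp, simp, rule nn_integral_cong) (simp add: indicator_def)
  ultimately have sing: "mutually_singular (density N f) (density N (indicator Z))"
    unfolding mutually_singular_def by (intro bexI[of _ Z]) auto
  have ac: "absolutely_continuous (density N f)
      (density (density N f) (\<lambda>x. ennreal (1 / f x)))"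
    by (rule absolutely_continuousI_density) simp
  have "emeasure N A = emeasure (density (density N f) (\<lambda>x. ennreal (1 / f x))) A +
      emeasure (density N (indicator Z)) A" if A[measurable]: "A \<in> sets N" for A
  proof -
    have "emeasure N A = (\<integral>\<^sup>+x. indicator A x \<partial>N)"
      using A by simp
    \<comment> \<open>Off \<open>Z\<close> the product is 1. On \<open>Z\<close> its factor
      \<open>f x\<close> is 0, and the second summand restores the indicator of
      \<open>A\<close>.\<close>
    also have "\<dots> = (\<integral>\<^sup>+x. ennreal (f x) * ennreal (1 / f x) * indicator A x +
        indicator Z x * indicator A x \<partial>N)"
      using nonneg
      by (intro nn_integral_cong)
        (auto simp: Z_def indicator_def simp flip: ennreal_mult)
    also have "\<dots> = (\<integral>\<^sup>+x. ennreal (f x) * ennreal (1 / f x) * indicator A x \<partial>N) +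
        (\<integral>\<^sup>+x. indicator Z x * indicator A x \<partial>N)"
      by (intro nn_integral_add) measurable
    also have "\<dots> = emeasure (density (density N f) (\<lambda>x. ennreal (1 / f x))) A +
        emeasure (density N (indicator Z)) A"
      using A by (simp add: density_density_eq emeasure_density)
    finally show ?thesis .
  qed
  then show ?thesis
    unfolding lebesgue_decomposition_def Z_def[symmetric] using sing ac by simp
qed

text \<open>This evaluates the initial-point factor of the detailed fluctuation relation.
  Sigma-finiteness of the reference measure makes the derivative unique almost everywhere, so it
  agrees with the explicit density found above.\<close>

lemma RN_deriv_ac_part_density:
  fixes f :: "'a \<Rightarrow> real"
  assumes f[measurable]: "f \<in> borel_measurable N" and "\<And>x. x \<in> space N \<Longrightarrow> 0 \<le> f x"
    and "sigma_finite_measure (density N f)"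
  shows "AE x in density N f.
    RN_deriv (density N f) (ac_part (density N f) N) x = ennreal (1 / f x)"
proof -
  have eq: "ac_part (density N f) N = density (density N f) (\<lambda>x. ennreal (1 / f x))"
    by (intro ac_part_eqI[OF lebesgue_decomposition_density] assms)
  show ?thesis
    unfolding eq
    using sigma_finite_measure.RN_deriv_unique[OF assms(3) _ refl, of "\<lambda>x. ennreal (1 / f x)"]
    by (auto elim!: eventually_mono)
qed

text \<open>The derivative is a density of the absolutely continuous part, so its integral is the
  total mass of that part.\<close>

lemma nn_integral_RN_deriv_ac_part:
  assumes M: "sigma_finite_measure M" and N: "finite_measure N" and sets: "sets N = sets M"
  shows "(\<integral>\<^sup>+x. RN_deriv M (ac_part M N) x \<partial>M)
    = ennreal (measure N (space M) - measure (sing_part M N) (space M))"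
proof -
  interpret N: finite_measure N by fact
  have D: "lebesgue_decomposition M N (ac_part M N) (sing_part M N)"
    by (rule lebesgue_decomposition_parts[OF N.sigma_finite_measure_axioms sets])
  then have ac: "absolutely_continuous M (ac_part M N)" and sets_ac: "sets (ac_part M N) = sets M"
    and add: "emeasure N (space M) =
      emeasure (ac_part M N) (space M) + emeasure (sing_part M N) (space M)"
    by (auto simp: lebesgue_decomposition_def)
  have "(\<integral>\<^sup>+x. RN_deriv M (ac_part M N) x \<partial>M) =
      emeasure (density M (RN_deriv M (ac_part M N))) (space M)"
    by (auto simp: emeasure_density intro!: nn_integral_cong)
  also have "\<dots> = emeasure (ac_part M N) (space M)"
    using sigma_finite_measure.density_RN_deriv[OF M ac sets_ac] by simp
  \<comment> \<open>The singular mass is bounded by the mass of \<open>N\<close>, hence finite, so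
    it may be cancelled in \<open>ennreal\<close>.\<close>
  also have "\<dots> = emeasure N (space M) - emeasure (sing_part M N) (space M)"
    using add N.emeasure_finite[of "space M"] by (auto simp: ennreal_add_diff_cancel_right)
  also have "\<dots> = ennreal (measure N (space M) - measure (sing_part M N) (space M))"
    using add N.emeasure_finite[of "space M"]
    by (simp add: N.emeasure_eq_measure emeasure_eq_ennreal_measure flip: ennreal_minus)
  finally show ?thesis .
qed

text \<open>Positivity of \<open>p0 (\<Gamma> 0)\<close> keeps its logarithm finite, so the entropy
  never takes the form infinity minus infinity, and keeps the factor
  \<open>1 / p0 (\<Gamma> 0)\<close> positive, so the right side never becomes 0 times
  infinity.\<close>

lemma ereal_exp_total_entropy:
  assumes "0 < k" and "0 < T" and "0 < p0 (\<Gamma> 0)"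
  shows "ereal_exp (- total_entropy k T Q \<tau> p0 p\<tau> \<Gamma> / ereal k) =
    ennreal (exp (- (1 / (k * T)) * Q \<Gamma>)) * ennreal (1 / p0 (\<Gamma> 0)) * p\<tau> (\<Gamma> \<tau>)"
proof -
  \<comment> \<open>Final density 0 gives entropy plus infinity and both sides 0; density infinity
    gives entropy minus infinity and both sides infinity. Only the third case needs real
    logarithms.\<close>
  consider "p\<tau> (\<Gamma> \<tau>) = 0" | "p\<tau> (\<Gamma> \<tau>) = \<infinity>" | y where "p\<tau> (\<Gamma> \<tau>) = ennreal y" "0 < y"
    by (cases "p\<tau> (\<Gamma> \<tau>)") (auto simp: less_le)
  then show ?thesis
  proof cases
    case 1
    then show ?thesis
      using assms
      by (simp add: total_entropy_def system_entropy_def ennreal_ln_def ereal_exp_def)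
  next
    case 2
    then show ?thesis
      using assms
      by (simp add: total_entropy_def system_entropy_def ennreal_ln_def ereal_exp_def
          ennreal_mult_top)
  next
    case 3
    have "- (Q \<Gamma> / T + (- k * ln y + k * ln (p0 (\<Gamma> 0)))) / k
        = - (1 / (k * T)) * Q \<Gamma> + ln y - ln (p0 (\<Gamma> 0))"
      using assms by (simp add: field_simps)
    then have "exp (- (Q \<Gamma> / T + (- k * ln y + k * ln (p0 (\<Gamma> 0)))) / k)
        = exp (- (1 / (k * T)) * Q \<Gamma>) * (1 / p0 (\<Gamma> 0)) * y"
      using assms 3 by (simp only: exp_diff exp_add exp_ln) simp
    then show ?thesis
      using assms 3
      by (simp add: total_entropy_def system_entropy_def bath_entropy_def ennreal_ln_def
          ereal_exp_def flip: ennreal_mult)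
  qed
qed

theorem mainTheorem4:
  fixes \<Omega> :: "'a::euclidean_space set"
    and \<mu>L \<mu>0 \<mu>\<tau> \<mu>0dag :: "'a measure"
    and \<tau> kB T \<beta> :: real
    and P M Mdag Mr :: "(real \<Rightarrow> 'a) measure"
    and \<theta> :: "'a \<Rightarrow> 'a"
    and Q :: "(real \<Rightarrow> 'a) \<Rightarrow> real"
    and p0 :: "'a \<Rightarrow> real"
    and p\<tau> :: "'a \<Rightarrow> ennreal"
    and lamS :: real
  assumes "\<Omega> \<in> sets borel" and "\<mu>L = phase_measure \<Omega>"
    and "0 \<le> \<tau>" and "0 < kB" and "0 < T" and "\<beta> = 1 / (kB * T)"
    and "path_space \<Omega> \<tau> P"
    and "Q \<in> borel_measurable P"
    \<comment> \<open>original process\<close>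
    and "prob_space M" and "sets M = sets P"
    and "distr M \<mu>L (\<lambda>\<Gamma>. \<Gamma> 0) = \<mu>0"
    and "distr M \<mu>L (\<lambda>\<Gamma>. \<Gamma> \<tau>) = \<mu>\<tau>"
    and "p0 \<in> borel_measurable \<mu>L" and "\<forall>x\<in>\<Omega>. 0 \<le> p0 x"
    and "\<mu>0 = density \<mu>L (\<lambda>x. ennreal (p0 x))"
    \<comment> \<open>time-reversed process, transported to forward paths\<close>
    and "\<theta> \<in> \<mu>L \<rightarrow>\<^sub>M \<mu>L" and "\<forall>x\<in>\<Omega>. \<theta> (\<theta> x) = x"
    and "time_reversal \<tau> \<theta> \<in> P \<rightarrow>\<^sub>M P"
    and "prob_space Mdag" and "sets Mdag = sets P"
    and "prob_space \<mu>0dag" and "sets \<mu>0dag = sets \<mu>L"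
    and "distr Mdag \<mu>L (\<lambda>\<Gamma>. \<Gamma> 0) = distr \<mu>0dag \<mu>L \<theta>"
    and "Mr = distr Mdag P (time_reversal \<tau> \<theta>)"
    and "\<mu>0dag = \<mu>\<tau>"
    and "detailed_fluctuation_relation \<beta> Q \<mu>L \<tau> \<mu>0 \<mu>0dag M Mr"
    and "p\<tau> = RN_deriv \<mu>L (ac_part \<mu>L \<mu>\<tau>)"
    and "lamS = measure (sing_part M Mr) (space M)"
  shows "(\<integral>\<^sup>+\<Gamma>. ereal_exp (- total_entropy kB T Q \<tau> p0 p\<tau> \<Gamma> / ereal kB) \<partial>M)
           = ennreal (1 - lamS)"
proof -
  interpret M: prob_space M by fact
  interpret Mdag: prob_space Mdag by fact
  have [measurable]: "p0 \<in> borel_measurable \<mu>L" by fact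
  have space_L: "space \<mu>L = \<Omega>"
    using assms(1,2) by (simp add: phase_measure_def space_restrict_space)
  have ev[measurable]: "(\<lambda>\<Gamma>. \<Gamma> 0) \<in> M \<rightarrow>\<^sub>M \<mu>L"
    using assms(2,3,7,10) by (auto simp: path_space_def cong: measurable_cong_sets)
  \<comment> \<open>As the law of the initial point under \<open>M\<close>, \<open>\<mu>0\<close> is
    a probability measure; this supplies the sigma-finiteness needed for uniqueness of the
    derivative.\<close>
  have "prob_space \<mu>0"
    using M.prob_space_distr[OF ev] assms(11) by simp
  then have sf: "sigma_finite_measure (density \<mu>L p0)"
    using assms(15) prob_space_imp_sigma_finite by blast
  have nonneg: "\<And>x. x \<in> space \<mu>L \<Longrightarrow> 0 \<le> p0 x"
    using assms(14) space_L by auto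
  have "AE x in \<mu>0. RN_deriv \<mu>0 (ac_part \<mu>0 \<mu>L) x = ennreal (1 / p0 x)"
    unfolding assms(15) by (rule RN_deriv_ac_part_density[OF assms(13) nonneg sf])
  \<comment> \<open>The points with \<open>p0 x = 0\<close> carry no mass under the density
    \<open>p0\<close>.\<close>
  moreover have "AE x in \<mu>0. 0 < p0 x"
    unfolding assms(15) by (subst AE_density) auto
  ultimately have "AE x in \<mu>0. RN_deriv \<mu>0 (ac_part \<mu>0 \<mu>L) x = ennreal (1 / p0 x) \<and> 0 < p0 x"
    by (rule AE_conjI)
  then have init: "AE \<Gamma> in M.
      RN_deriv \<mu>0 (ac_part \<mu>0 \<mu>L) (\<Gamma> 0) = ennreal (1 / p0 (\<Gamma> 0)) \<and> 0 < p0 (\<Gamma> 0)"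
    using AE_distrD[OF ev] assms(11) by blast
  have "time_reversal \<tau> \<theta> \<in> Mdag \<rightarrow>\<^sub>M P"
    using assms(18,20) by (simp cong: measurable_cong_sets)
  then have Mr: "prob_space Mr"
    unfolding assms(24) by (rule Mdag.prob_space_distr)
  have sets_Mr: "sets Mr = sets M"
    using assms(10,24) by simp
  have "AE \<Gamma> in M. ereal_exp (- total_entropy kB T Q \<tau> p0 p\<tau> \<Gamma> / ereal kB) =
      RN_deriv M (ac_part M Mr) \<Gamma>"
    using init assms(26)[unfolded detailed_fluctuation_relation_def]
  proof eventually_elim
    case (elim \<Gamma>)
    \<comment> \<open>With \<open>\<mu>0dag = \<mu>\<tau>\<close>, the final factor of the relation
      is literally \<open>p\<tau>\<close>, the same version of the derivative. Hence the two agree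
      pointwise, even where a singular part of \<open>\<mu>\<tau>\<close> sits.\<close>
    then show ?case
      using ereal_exp_total_entropy[of kB T p0 \<Gamma> Q \<tau> p\<tau>] assms(4-6,25,27) by simp
  qed
  then have "(\<integral>\<^sup>+\<Gamma>. ereal_exp (- total_entropy kB T Q \<tau> p0 p\<tau> \<Gamma> / ereal kB) \<partial>M) =
      (\<integral>\<^sup>+\<Gamma>. RN_deriv M (ac_part M Mr) \<Gamma> \<partial>M)"
    by (rule nn_integral_cong_AE)
  also have "\<dots> =
      ennreal (measure Mr (space M) - measure (sing_part M Mr) (space M))"
    by (intro nn_integral_RN_deriv_ac_part M.sigma_finite_measure_axioms
        prob_space.finite_measure Mr sets_Mr)
  also have "\<dots> = ennreal (1 - lamS)"
    using prob_space.prob_space[OF Mr] sets_eq_imp_space_eq[OF sets_Mr] assms(28) by simp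
  finally show ?thesis .
qed

end
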